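(* Let $G$ be a connected, undirected (finite, simple) graph with vertex set $V$, $|V|=n\ge 1$, and let $G'$ be the graph formed from $G$ by adding one new vertex and connecting it by an edge to every vertex of $G$. For $1\leq k\leq n$ let $\mathcal{L}_k(G)$ denote the number of random walk labelings of $G$ that are disrupted immediately after the $k$th vertex has been labeled, and set $\mathcal{L}_0(G)=1$. Then $$\mathcal{L}(G')=\sum_{k=0}^{n}(n-k)!\,\mathcal{L}_k(G).$$
   Context: Let $H$ be a finite, connected, undirected graph with vertex set $V$. A random walk labeling of $H$ is a labeling of $V$ obtainable by the following process: (1) set $i=1$, choose any $v\in V$ and label $v$ with $i$; (2) as long as there are unlabeled vertices, choose a vertex $w$ adjacent to the current vertex $v$ and replace $v$ by $w$; if this new $v$ is not labeled, increase $i$ by $1$ and label $v$ with $i$. The number of different random walk labelings of $H$ is denoted by $\mathcal{L}(H)$. For $1\le k\le |V|$, $\mathcal{L}_k(H)$ is the number of different partial labelings of $H$ (exactly $k$ vertices carrying the labels $1,\dots,k$, the others unlabeled) that can be obtained by running the same process and stopping it immediately after label $k$ has been assigned. *)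

theory Defs
  imports "Graph_Theory.Pair_Digraph" "Graph_Theory.Digraph_Component"
begin

text \<open>A state of the random walk labeling process consists of the current partial labeling \<open>l\<close>,
  the counter \<open>i\<close> and the current vertex \<open>v\<close>; \<open>rw_state H l i v\<close> says that some run of the
  process on \<open>H\<close> reaches it.  The process moves only while there are unlabeled vertices.\<close>

inductive rw_state ::
    "'a pair_pre_digraph \<Rightarrow> ('a \<Rightarrow> nat option) \<Rightarrow> nat \<Rightarrow> 'a \<Rightarrow> bool"
  for H :: "'a pair_pre_digraph" where
  start: "v \<in> pverts H \<Longrightarrow> rw_state H [v \<mapsto> 1] 1 v"
| move_labeled:
    "rw_state H l i v \<Longrightarrow> dom l \<noteq> pverts H \<Longrightarrow> (v, w) \<in> parcs H \<Longrightarrow> w \<in> dom l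
      \<Longrightarrow> rw_state H l i w"
| move_unlabeled:
    "rw_state H l i v \<Longrightarrow> dom l \<noteq> pverts H \<Longrightarrow> (v, w) \<in> parcs H \<Longrightarrow> w \<notin> dom l
      \<Longrightarrow> rw_state H (l(w \<mapsto> i + 1)) (i + 1) w"

definition rw_labelings :: "'a pair_pre_digraph \<Rightarrow> ('a \<Rightarrow> nat option) set" where
  "rw_labelings H = {l. \<exists>i v. rw_state H l i v \<and> dom l = pverts H}"

definition num_rw_labelings :: "'a pair_pre_digraph \<Rightarrow> nat" where
  "num_rw_labelings H = card (rw_labelings H)"

text \<open>Every state with counter \<open>k\<close> carries exactly the labeling that was present immediately after
  label \<open>k\<close> had been assigned, since moves to labeled vertices do not change the labeling.\<close>

definition partial_rw_labelings ::
    "'a pair_pre_digraph \<Rightarrow> nat \<Rightarrow> ('a \<Rightarrow> nat option) set" where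
  "partial_rw_labelings H k = {l. \<exists>v. rw_state H l k v}"

text \<open>The value at \<open>k = 0\<close> is a convention: the process itself assigns label 1 at once.\<close>

definition num_partial_rw_labelings :: "'a pair_pre_digraph \<Rightarrow> nat \<Rightarrow> nat" where
  "num_partial_rw_labelings H k = (if k = 0 then 1 else card (partial_rw_labelings H k))"

text \<open>An undirected edge is a pair of opposite arcs.  The vertex \<open>u\<close> is new when
  \<open>u \<notin> pverts G\<close>.\<close>

definition add_universal_vertex :: "'a \<Rightarrow> 'a pair_pre_digraph \<Rightarrow> 'a pair_pre_digraph" where
  "add_universal_vertex u G =
     \<lparr> pverts = insert u (pverts G),
       parcs = parcs G \<union> {u} \<times> pverts G \<union> pverts G \<times> {u} \<rparr>"

lemma pair_graph_add_universal_vertex: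
  assumes "pair_graph G" and "u \<notin> pverts G"
  shows "pair_graph (add_universal_vertex u G)"
proof -
  interpret pair_graph G by fact
  have sym: "(y, x) \<in> parcs G" if "(x, y) \<in> parcs G" for x y
    using that pair_sym_arcs by (auto simp: symmetric_def dest: symD)
  show ?thesis
    using assms(2) sym pair_finite_verts pair_finite_arcs
    by unfold_locales
      (auto simp: add_universal_vertex_def symmetric_def sym_def
        dest: in_arcsD1 in_arcsD2 pair_no_loops)
qed

end

theory Submission
  imports Defs "HOL-Combinatorics.Multiset_Permutations"
begin

text \<open>List the vertices of a labeling in the order in which they are labeled.  In a labeling of
  \<open>G'\<close> with the new vertex \<open>u\<close> in position \<open>k + 1\<close>, the walk stays inside \<open>G\<close> until \<open>u\<close> is reached,
  so the first \<open>k\<close> vertices come from a walk on \<open>G\<close> disrupted after the \<open>k\<close>th label.  Once \<open>u\<close> is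
  labeled, the walk may return to \<open>u\<close> after each step and visit the other vertices in any order,
  so every one of the \<open>(n - k)!\<close> orders of the remaining vertices occurs.\<close>

section \<open>Labelings as vertex orders\<close>

definition list_labeling :: "'a list \<Rightarrow> 'a \<Rightarrow> nat option" where
  "list_labeling xs = map_of (zip xs [1..<Suc (length xs)])"

lemma dom_list_labeling [simp]: "dom (list_labeling xs) = set xs"
  by (simp add: list_labeling_def del: upt_Suc)

lemma list_labeling_snoc:
  assumes "w \<notin> set xs"
  shows "list_labeling (xs @ [w]) = (list_labeling xs)(w \<mapsto> length xs + 1)"
proof -
  \<comment> \<open>Under \<open>map_of\<close>, earlier entries of an appended list take
    precedence, so the new entry for \<open>w\<close> counts only because \<open>w\<close> has no
    label yet.\<close>
  have "list_labeling xs w = None"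
    using assms by (metis dom_list_labeling domIff)
  moreover have "[1..<Suc (length (xs @ [w]))] = [1..<Suc (length xs)] @ [Suc (length xs)]"
    by simp
  then have "list_labeling (xs @ [w]) = [w \<mapsto> Suc (length xs)] ++ list_labeling xs"
    by (simp add: list_labeling_def del: upt_Suc)
  ultimately show ?thesis
    by (auto simp: fun_eq_iff map_add_def split: option.splits)
qed

lemma list_labeling_nth:
  assumes "distinct xs" "i < length xs"
  shows "list_labeling xs (xs ! i) = Some (Suc i)"
  using assms map_of_zip_nth[of xs "[1..<Suc (length xs)]" i]
  by (simp add: list_labeling_def del: upt_Suc)

text \<open>The label of a vertex gives its position, and the labeled set gives the length. Counting
  labelings thereby becomes counting repetition-free vertex orders.\<close>

lemma inj_on_list_labeling: "inj_on list_labeling {xs. distinct xs}"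
proof (rule inj_onI, clarsimp)
  fix xs ys :: "'a list"
  assume d: "distinct xs" "distinct ys" and eq: "list_labeling xs = list_labeling ys"
  from eq have s: "set xs = set ys"
    by (metis dom_list_labeling)
  then have len: "length xs = length ys"
    using d by (metis distinct_card)
  show "xs = ys"
  proof (rule nth_equalityI[OF len])
    fix i assume i: "i < length xs"
    then obtain j where j: "j < length ys" "ys ! j = xs ! i"
      using s by (metis in_set_conv_nth nth_mem)
    then have "Some (Suc i) = Some (Suc j)"
      using list_labeling_nth[OF d(1) i] list_labeling_nth[OF d(2) j(1)] eq by simp
    then show "xs ! i = ys ! i" using j by simp
  qed
qed

text \<open>Orders of interrupted runs of every length are collected. The empty list is never a
  member, since a run labels its start vertex at once; it is inserted by hand for the case that
  \<open>u\<close> comes first.\<close>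

definition rw_lists :: "'a pair_pre_digraph \<Rightarrow> 'a list set" where
  "rw_lists H = {xs. distinct xs \<and> (\<exists>v. rw_state H (list_labeling xs) (length xs) v)}"

text \<open>Induction on the run: a move to an unlabeled vertex appends it to the list, any other
  move keeps the list. The clause \<open>v \<in> set xs\<close> makes the list nonempty.\<close>

lemma rw_state_list_labeling:
  assumes "pair_wf_digraph H" "rw_state H l i v"
  shows "\<exists>xs. l = list_labeling xs \<and> i = length xs \<and> distinct xs \<and> set xs \<subseteq> pverts H \<and> v \<in> set xs"
  using assms(2)
proof induction
  case (start v)
  then show ?case
    by (intro exI[of _ "[v]"]) (simp add: list_labeling_def)
next
  case (move_labeled l i v w)
  then show ?case by (metis dom_list_labeling)
next
  case (move_unlabeled l i v w)
  then obtain xs where xs: "l = list_labeling xs" "i = length xs" "distinct xs"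
      "set xs \<subseteq> pverts H" by blast
  have "w \<in> pverts H"
    using move_unlabeled.hyps assms(1) by (meson pair_wf_digraph.in_arcsD2)
  with xs move_unlabeled.hyps show ?case
    by (intro exI[of _ "xs @ [w]"]) (simp add: list_labeling_snoc)
qed

lemma dom_rw_state:
  assumes "pair_wf_digraph H" "rw_state H l i v"
  shows "dom l \<subseteq> pverts H"
  using rw_state_list_labeling[OF assms] by (metis dom_list_labeling)

text \<open>Injectivity identifies \<open>xs\<close> with the list that the run invariant provides,
  so the invariant's properties pass to \<open>xs\<close>.\<close>

lemma rw_lists_props:
  assumes "pair_wf_digraph H" "xs \<in> rw_lists H"
  shows "distinct xs" "set xs \<subseteq> pverts H" "xs \<noteq> []"
proof -
  obtain v where d: "distinct xs" and st: "rw_state H (list_labeling xs) (length xs) v"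
    using assms(2) by (auto simp: rw_lists_def)
  obtain ys where "list_labeling xs = list_labeling ys" "distinct ys"
      "set ys \<subseteq> pverts H" "v \<in> set ys"
    using rw_state_list_labeling[OF assms(1) st] by blast
  moreover from this d have "xs = ys"
    using inj_on_list_labeling by (metis inj_onD mem_Collect_eq)
  ultimately show "distinct xs" "set xs \<subseteq> pverts H" "xs \<noteq> []" by auto
qed

lemma finite_rw_lists:
  assumes "pair_wf_digraph H" "finite (pverts H)"
  shows "finite (rw_lists H)"
proof (rule finite_subset)
  show "rw_lists H \<subseteq> {xs. set xs \<subseteq> pverts H \<and> distinct xs}"
    using rw_lists_props[OF assms(1)] by auto
  show "finite {xs. set xs \<subseteq> pverts H \<and> distinct xs}"
    using assms(2) by (rule finite_subset_distinct)
qed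

lemma card_partial_rw_labelings:
  assumes "pair_wf_digraph H"
  shows "card (partial_rw_labelings H k) = card {xs \<in> rw_lists H. length xs = k}"
proof -
  have "partial_rw_labelings H k = list_labeling ` {xs \<in> rw_lists H. length xs = k}"
    using rw_state_list_labeling[OF assms]
    by (fastforce simp: partial_rw_labelings_def rw_lists_def image_iff)
  moreover have "inj_on list_labeling {xs \<in> rw_lists H. length xs = k}"
    by (rule inj_on_subset[OF inj_on_list_labeling]) (auto simp: rw_lists_def)
  ultimately show ?thesis by (simp add: card_image)
qed

lemma card_rw_labelings:
  assumes "pair_wf_digraph H"
  shows "num_rw_labelings H = card {xs \<in> rw_lists H. set xs = pverts H}"
proof -
  have "rw_labelings H = list_labeling ` {xs \<in> rw_lists H. set xs = pverts H}"
    using rw_state_list_labeling[OF assms]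
    by (fastforce simp: rw_labelings_def rw_lists_def image_iff)
  moreover have "inj_on list_labeling {xs \<in> rw_lists H. set xs = pverts H}"
    by (rule inj_on_subset[OF inj_on_list_labeling]) (auto simp: rw_lists_def)
  ultimately show ?thesis by (simp add: num_rw_labelings_def card_image)
qed

section \<open>Runs on the graph with the new vertex\<close>

lemma pverts_add_universal_vertex [simp]:
  "pverts (add_universal_vertex u G) = insert u (pverts G)"
  by (simp add: add_universal_vertex_def)

lemma parcs_add_universal_vertex:
  "parcs (add_universal_vertex u G) = parcs G \<union> {u} \<times> pverts G \<union> pverts G \<times> {u}"
  by (simp add: add_universal_vertex_def)

text \<open>In the first alternative for \<open>u \<notin> set xs\<close> the walk is still a run of the process on \<open>G\<close>; in the
  second it has labeled all of \<open>G\<close>, so the process on \<open>G\<close> has stopped while that on \<open>G'\<close> goes on.\<close>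

lemma rw_state_add_universal_vertexD:
  assumes wf: "pair_wf_digraph G" and "u \<notin> pverts G"
    and "rw_state (add_universal_vertex u G) l i v"
  shows "\<exists>xs. l = list_labeling xs \<and> i = length xs \<and> distinct xs \<and> v \<in> set xs \<and>
    (if u \<in> set xs then \<exists>ys zs. xs = ys @ u # zs \<and> ys \<in> insert [] (rw_lists G)
     else rw_state G l i v \<or> set xs = pverts G \<and> xs \<in> rw_lists G)"
  using assms(3)
proof induction
  case (start v)
  show ?case
  proof (intro exI[of _ "[v]"] conjI)
    show "[v \<mapsto> 1] = list_labeling [v]" by (simp add: list_labeling_def)
    show "if u \<in> set [v] then \<exists>ys zs. [v] = ys @ u # zs \<and> ys \<in> insert [] (rw_lists G)
     else rw_state G [v \<mapsto> 1] 1 v \<or> set [v] = pverts G \<and> [v] \<in> rw_lists G"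
      using start rw_state.start[of v G] by auto
  qed auto
next
  case (move_labeled l i v w)
  then obtain xs where xs: "l = list_labeling xs" "i = length xs" "distinct xs" "v \<in> set xs" and
    P: "if u \<in> set xs then \<exists>ys zs. xs = ys @ u # zs \<and> ys \<in> insert [] (rw_lists G)
     else rw_state G l i v \<or> set xs = pverts G \<and> xs \<in> rw_lists G" by blast
  have w: "w \<in> set xs" using move_labeled xs by simp
  have "rw_state G l i w \<or> set xs = pverts G \<and> xs \<in> rw_lists G" if "u \<notin> set xs"
  proof (cases "set xs = pverts G")
    case True
    then show ?thesis using that P xs by (auto simp: rw_lists_def)
  next
    case False
    \<comment> \<open>The arc avoids \<open>u\<close>, since both of its ends lie in
      \<open>xs\<close>.\<close>
    have "(v, w) \<in> parcs G"
      using move_labeled.hyps xs w that by (auto simp: parcs_add_universal_vertex)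
    then show ?thesis
      using rw_state.move_labeled[of G l i v w] False that P xs w by auto
  qed
  then show ?case using xs P w by (intro exI[of _ xs]) auto
next
  case (move_unlabeled l i v w)
  then obtain xs where xs: "l = list_labeling xs" "i = length xs" "distinct xs" "v \<in> set xs" and
    P: "if u \<in> set xs then \<exists>ys zs. xs = ys @ u # zs \<and> ys \<in> insert [] (rw_lists G)
     else rw_state G l i v \<or> set xs = pverts G \<and> xs \<in> rw_lists G" by blast
  have w: "w \<notin> set xs" using move_unlabeled xs by simp
  have Q: "if u \<in> set (xs @ [w])
     then \<exists>ys zs. xs @ [w] = ys @ u # zs \<and> ys \<in> insert [] (rw_lists G)
     else rw_state G (l(w \<mapsto> i + 1)) (i + 1) w \<or>
       set (xs @ [w]) = pverts G \<and> xs @ [w] \<in> rw_lists G"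
  proof (cases "u \<in> set xs")
    case True
    with P obtain ys zs where "xs = ys @ u # zs" "ys \<in> insert [] (rw_lists G)" by auto
    then have "xs @ [w] = ys @ u # (zs @ [w])" "ys \<in> insert [] (rw_lists G)" by simp_all
    with True show ?thesis by (metis UnI1 set_append)
  next
    case u: False
    \<comment> \<open>Both alternatives in \<open>P\<close> give this. If the next vertex is
      \<open>u\<close>, the order splits into the prefix \<open>xs\<close> and an empty
      rest.\<close>
    have xR: "xs \<in> rw_lists G" using u P xs by (auto simp: rw_lists_def)
    show ?thesis
    proof (cases "w = u")
      case True
      with xR show ?thesis by auto
    next
      case False
      have "(v, w) \<in> parcs G"
        using move_unlabeled.hyps xs False u by (auto simp: parcs_add_universal_vertex)
      moreover from this have "w \<in> pverts G"
        using wf by (meson pair_wf_digraph.in_arcsD2)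
      \<comment> \<open>The vertex \<open>w\<close> of \<open>G\<close> is unlabeled, which excludes
        \<open>set xs = pverts G\<close>; the run on \<open>G\<close> has not stopped and can make
        the same move.\<close>
      ultimately have "rw_state G (l(w \<mapsto> i + 1)) (i + 1) w"
        using u P w xs by (intro rw_state.move_unlabeled[of G l i v w]) auto
      then show ?thesis using u False by auto
    qed
  qed
  then show ?case using xs w by (intro exI[of _ "xs @ [w]"]) (auto simp: list_labeling_snoc)
qed

text \<open>All arcs of \<open>G\<close> are kept, and the stopping condition never interferes
  because \<open>u\<close> stays unlabeled throughout a run on \<open>G\<close>.\<close>

lemma rw_state_add_universal_vertexI:
  assumes wf: "pair_wf_digraph G" and u: "u \<notin> pverts G" and "rw_state G l i v"
  shows "rw_state (add_universal_vertex u G) l i v"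
  using assms(3)
proof induction
  case (start v)
  then show ?case by (intro rw_state.start) simp
next
  case (move_labeled l i v w)
  have "dom l \<subseteq> pverts G"
    using wf move_labeled.hyps(1) by (rule dom_rw_state)
  with u move_labeled show ?case
    by (intro rw_state.move_labeled[of _ l i v w]) (auto simp: parcs_add_universal_vertex)
next
  case (move_unlabeled l i v w)
  have "dom l \<subseteq> pverts G"
    using wf move_unlabeled.hyps(1) by (rule dom_rw_state)
  with u move_unlabeled show ?case
    by (intro rw_state.move_unlabeled[of _ l i v w]) (auto simp: parcs_add_universal_vertex)
qed

text \<open>Returning to \<open>u\<close> after each new label puts every vertex of \<open>G\<close>
  within one step. The invariant \<open>v = u\<close> is limited to incomplete labelings, as the
  process makes no move after the last label.\<close>

lemma rw_state_after_universal_vertex: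
  assumes wf: "pair_wf_digraph G" and u: "u \<notin> pverts G"
    and xs: "xs \<in> insert [] (rw_lists G)"
    and "distinct (xs @ u # zs)" "set zs \<subseteq> pverts G"
  shows "\<exists>v. rw_state (add_universal_vertex u G) (list_labeling (xs @ u # zs))
      (length (xs @ u # zs)) v \<and> (set (xs @ u # zs) \<noteq> insert u (pverts G) \<longrightarrow> v = u)"
  using assms(4,5)
proof (induction zs rule: rev_induct)
  case Nil
  let ?H = "add_universal_vertex u G"
  have "rw_state ?H (list_labeling (xs @ [u])) (length (xs @ [u])) u"
  proof (cases "xs = []")
    case True
    then show ?thesis using rw_state.start[of u ?H] by (simp add: list_labeling_def)
  next
    case False
    with xs have xR: "xs \<in> rw_lists G" by simp
    then obtain v where v: "rw_state G (list_labeling xs) (length xs) v"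
      by (auto simp: rw_lists_def)
    have "v \<in> set xs" "set xs \<subseteq> pverts G"
      using rw_state_list_labeling[OF wf v] by (metis dom_list_labeling)+
    then show ?thesis
      using rw_state.move_unlabeled[OF rw_state_add_universal_vertexI[OF wf u v], of u] u Nil
      by (auto simp: parcs_add_universal_vertex list_labeling_snoc)
  qed
  then show ?case by blast
next
  case (snoc w zs)
  let ?H = "add_universal_vertex u G" and ?ys = "xs @ u # zs"
  have w: "w \<in> pverts G" "w \<notin> set ?ys" using snoc.prems by auto
  then have nf: "set ?ys \<noteq> insert u (pverts G)" by auto
  then have "rw_state ?H (list_labeling ?ys) (length ?ys) u"
    using snoc by auto
  from rw_state.move_unlabeled[OF this, of w]
  have st: "rw_state ?H (list_labeling (?ys @ [w])) (length (?ys @ [w])) w"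
    using w nf list_labeling_snoc[OF w(2)] by (simp add: parcs_add_universal_vertex)
  show ?case
  proof (cases "set (?ys @ [w]) = insert u (pverts G)")
    case True
    then show ?thesis using st by auto
  next
    case False
    \<comment> \<open>The walk goes back to \<open>u\<close>, which is allowed because some vertex
      is still unlabeled.\<close>
    from rw_state.move_labeled[OF st, of u]
    have "rw_state ?H (list_labeling (?ys @ [w])) (length (?ys @ [w])) u"
      using False w by (simp add: parcs_add_universal_vertex)
    then show ?thesis by auto
  qed
qed

section \<open>Counting by the position of the new vertex\<close>

lemma rw_lists_add_universal_vertex:
  assumes "pair_graph G" and u: "u \<notin> pverts G"
  shows "{xs \<in> rw_lists (add_universal_vertex u G). set xs = insert u (pverts G)} =
    (\<lambda>(xs, zs). xs @ u # zs) `
      (SIGMA xs : insert [] (rw_lists G). permutations_of_set (pverts G - set xs))"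
    (is "?L = ?R")
proof -
  interpret G: pair_graph G by fact
  have wf: "pair_wf_digraph G" by unfold_locales
  show ?thesis
  proof (intro equalityI subsetI)
    fix as assume "as \<in> ?L"
    then obtain v where d: "distinct as" and s: "set as = insert u (pverts G)"
      and v: "rw_state (add_universal_vertex u G) (list_labeling as) (length as) v"
      by (auto simp: rw_lists_def)
    obtain bs where "list_labeling as = list_labeling bs" "distinct bs"
        "u \<in> set bs \<longrightarrow> (\<exists>ys zs. bs = ys @ u # zs \<and> ys \<in> insert [] (rw_lists G))"
      using rw_state_add_universal_vertexD[OF wf u v] by metis
    moreover from this d have "as = bs"
      using inj_on_list_labeling by (metis inj_onD mem_Collect_eq)
    ultimately obtain ys zs where as: "as = ys @ u # zs" "ys \<in> insert [] (rw_lists G)"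
      using s by auto
    have "insert u (set ys \<union> set zs) = insert u (pverts G)" "u \<notin> set ys \<union> set zs"
      using s d as(1) by auto
    with u have "set ys \<union> set zs = pverts G"
      by (meson insert_ident)
    then have "zs \<in> permutations_of_set (pverts G - set ys)"
      using d as(1) by (intro permutations_of_setI) auto
    then show "as \<in> ?R" using as by auto
  next
    fix as assume "as \<in> ?R"
    then obtain ys zs where as: "as = ys @ u # zs" "ys \<in> insert [] (rw_lists G)"
      "set zs = pverts G - set ys" "distinct zs"
      by (auto simp: permutations_of_set_def)
    have y: "set ys \<subseteq> pverts G" "distinct ys"
      using as(2) rw_lists_props[OF wf] by auto
    then have d: "distinct as" "set as = insert u (pverts G)" using as u by auto
    show "as \<in> ?L"
      using rw_state_after_universal_vertex[OF wf u as(2), of zs] d as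
      by (auto simp: rw_lists_def)
  qed
qed

theorem theorem1:
  fixes G :: "'a pair_pre_digraph" and u :: 'a and n :: nat
  assumes "pair_graph G"
    and "connected (with_proj G)"
    and "card (pverts G) = n" and "n \<ge> 1"
    and "u \<notin> pverts G"
  shows "num_rw_labelings (add_universal_vertex u G) =
    (\<Sum>k = 0..n. fact (n - k) * num_partial_rw_labelings G k)"
proof -
  let ?H = "add_universal_vertex u G"
  let ?R = "insert [] (rw_lists G)"
  let ?S = "SIGMA xs : ?R. permutations_of_set (pverts G - set xs)"
  interpret G: pair_graph G by fact
  have wf: "pair_wf_digraph G" by unfold_locales
  interpret H: pair_graph ?H
    using assms(1,5) by (rule pair_graph_add_universal_vertex)
  have wfH: "pair_wf_digraph ?H" by unfold_locales
  have fin: "finite (pverts G)" "finite ?R"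
    using finite_rw_lists[OF wf] by auto
  have R: "distinct xs" "set xs \<subseteq> pverts G" if "xs \<in> ?R" for xs
    using that rw_lists_props[OF wf] by auto
  have card_set: "card (set xs) = length xs" if "xs \<in> ?R" for xs
    using R(1)[OF that] by (rule distinct_card)
  have len: "length xs \<le> n" if "xs \<in> ?R" for xs
    using card_mono[OF fin(1) R(2)[OF that]] card_set[OF that] assms(3) by simp
  have inj: "inj_on (\<lambda>(xs, zs). xs @ u # zs) ?S"
  proof (rule inj_onI, clarify)
    fix xs zs xs' zs'
    assume a: "xs \<in> ?R" "xs' \<in> ?R" "zs \<in> permutations_of_set (pverts G - set xs)"
      "zs' \<in> permutations_of_set (pverts G - set xs')" "xs @ u # zs = xs' @ u # zs'"
    then have "u \<notin> set xs" "u \<notin> set zs"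
      using R(2) assms(5) by (auto simp: permutations_of_set_def)
    \<comment> \<open>The single occurrence of \<open>u\<close> marks where the list is cut.\<close>
    with a(5) show "xs = xs' \<and> zs = zs'"
      by (simp add: append_Cons_eq_iff)
  qed
  \<comment> \<open>For \<open>k = 0\<close> the inserted empty list is the only member, in
    agreement with the conventional value 1.\<close>
  have parts: "card {xs \<in> ?R. length xs = k} = num_partial_rw_labelings G k" for k
  proof (cases "k = 0")
    case True
    then have "{xs \<in> ?R. length xs = k} = {[]}" by auto
    with True show ?thesis by (simp add: num_partial_rw_labelings_def)
  next
    case False
    then have "{xs \<in> ?R. length xs = k} = {xs \<in> rw_lists G. length xs = k}" by auto
    with False show ?thesis
      by (simp add: num_partial_rw_labelings_def card_partial_rw_labelings[OF wf])
  qed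
  have "num_rw_labelings ?H = card ?S"
    using card_rw_labelings[OF wfH] rw_lists_add_universal_vertex[OF assms(1,5)] inj
    by (simp add: card_image)
  also have "\<dots> = (\<Sum>xs\<in>?R. card (permutations_of_set (pverts G - set xs)))"
    using fin by (intro card_SigmaI) auto
  also have "\<dots> = (\<Sum>xs\<in>?R. fact (n - length xs))"
    using fin(1) R(2) card_set assms(3)
    by (intro sum.cong refl) (simp add: card_Diff_subset del: insert_iff)
  \<comment> \<open>Prefixes are grouped by length; \<open>len\<close> keeps every length within
    \<open>0..n\<close>.\<close>
  also have "\<dots> = (\<Sum>k = 0..n. \<Sum>xs\<in>{xs \<in> ?R. length xs = k}. fact (n - length xs))"
    using fin(2) len by (intro sum.group[symmetric]) auto
  also have "\<dots> = (\<Sum>k = 0..n. fact (n - k) * num_partial_rw_labelings G k)"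
    unfolding parts[symmetric] by (intro sum.cong refl) (simp del: insert_iff)
  finally show ?thesis .
qed

end
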